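(* Let $K$ be a nonempty compact subset of $X$ and let $F:X\to 2^Y$ be a set-valued mapping. Assume that $K$ is starshaped and that $F$ is $-C$-continuous and strictly quasi $u$-$C$-convexlike on $K$ with nonempty, $-C$-convex and $-C$-compact values. Then the weak $u$-minimal solution set $W_u(F,K)$ and the $u$-minimal solution set $E_u(F,K)$ are both contractible.
   Context: $X$ is a (real) normed vector space, $Y$ is a (real) Banach space, and $C\subseteq Y$ is a convex, closed, pointed cone with nonempty interior $\operatorname{int}C$. For nonempty $A,B\subseteq Y$: $A\le^u B$ means $A\subseteq B-C$; $A\ll^u B$ means $A\subseteq B-\operatorname{int}C$. $E_u(F,K)$ is the set of $x_0\in K$ such that for every $x\in K$, $F(x)\le^u F(x_0)$ implies $F(x_0)\le^u F(x)$. $W_u(F,K)$ is the set of $x_0\in K$ such that for every $x\in K$, $F(x)\ll^u F(x_0)$ implies $F(x_0)\ll^u F(x)$. $F$ is strictly quasi $u$-$C$-convexlike on $K$ if for any $x_1,x_2\in K$ with $x_1\neq x_2$ there exist $x_3\in K$ and $t_0\in[0,1]$ such that $F(x_3)\ll^u t_0F(x_1)+(1-t_0)F(x_2)$. A set $A\subseteq Y$ is $-C$-convex if $A-C$ is convex, and $-C$-compact if any cover of $A$ of the form $\{U_\alpha-C: U_\alpha \text{ open}\}$ admits a finite subcover. "With ... values" means that $F(x)$ has the stated properties for $x\in K$. $F$ is $-C$-upper semicontinuous at $u_0$ if for any neighborhood $V$ of the set $F(u_0)$ there is a neighborhood $U(u_0)$ of $u_0$ such that $F(u)\subseteq V-C$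 for every $u\in U(u_0)$. $F$ is $-C$-lower semicontinuous at $u_0$ if for any $x\in F(u_0)$ and any neighborhood $V$ of $x$ there is a neighborhood $U(u_0)$ of $u_0$ such that $F(u)\cap(V+C)\neq\emptyset$ for every $u\in U(u_0)$. $F$ is $-C$-continuous on $K$ if it is both $-C$-upper and $-C$-lower semicontinuous at each point of $K$. $K$ is starshaped if there is $x_0\in K$ such that $\lambda x_0+(1-\lambda)y\in K$ for all $\lambda\in[0,1]$ and $y\in K$. A nonempty set $A$ in a topological space is contractible if there exist $x_0\in A$ and a continuous mapping $H:A\times[0,1]\to A$ such that $H(x,1)=x$ and $H(x,0)=x_0$ for any $x\in A$. *)

theory Defs
  imports "HOL-Analysis.Analysis" "HOL-Library.Set_Algebras"
begin

text \<open>
  On sets, \<open>-\<close> is set difference in Isabelle/HOL, so the Minkowski difference gets its own symbol;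
  \<open>+\<close> is the Minkowski sum of \<^theory>\<open>HOL-Library.Set_Algebras\<close>.
\<close>

abbreviation mdiff :: "'b::ab_group_add set \<Rightarrow> 'b set \<Rightarrow> 'b set"  (infixl \<open>\<ominus>\<close> 65)
  where "A \<ominus> B \<equiv> A + uminus ` B"

definition pointed_cone :: "'b::real_vector set \<Rightarrow> bool"
  where "pointed_cone C \<longleftrightarrow> cone C \<and> C \<inter> uminus ` C = {0}"

definition u_le :: "'b::real_normed_vector set \<Rightarrow> 'b set \<Rightarrow> 'b set \<Rightarrow> bool"
  where "u_le C A B \<longleftrightarrow> A \<subseteq> B \<ominus> C"

definition u_less :: "'b::real_normed_vector set \<Rightarrow> 'b set \<Rightarrow> 'b set \<Rightarrow> bool"
  where "u_less C A B \<longleftrightarrow> A \<subseteq> B \<ominus> interior C"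

definition u_minimal ::
    "'b::real_normed_vector set \<Rightarrow> ('a \<Rightarrow> 'b set) \<Rightarrow> 'a set \<Rightarrow> 'a set"
  where "u_minimal C F K =
    {x\<^sub>0 \<in> K. \<forall>x\<in>K. u_le C (F x) (F x\<^sub>0) \<longrightarrow> u_le C (F x\<^sub>0) (F x)}"

definition weak_u_minimal ::
    "'b::real_normed_vector set \<Rightarrow> ('a \<Rightarrow> 'b set) \<Rightarrow> 'a set \<Rightarrow> 'a set"
  where "weak_u_minimal C F K =
    {x\<^sub>0 \<in> K. \<forall>x\<in>K. u_less C (F x) (F x\<^sub>0) \<longrightarrow> u_less C (F x\<^sub>0) (F x)}"

definition strictly_quasi_u_convexlike_on ::
    "'b::real_normed_vector set \<Rightarrow> ('a \<Rightarrow> 'b set) \<Rightarrow> 'a set \<Rightarrow> bool"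
  where "strictly_quasi_u_convexlike_on C F K \<longleftrightarrow>
    (\<forall>x\<^sub>1\<in>K. \<forall>x\<^sub>2\<in>K. x\<^sub>1 \<noteq> x\<^sub>2 \<longrightarrow>
      (\<exists>x\<^sub>3\<in>K. \<exists>t\<^sub>0\<in>{0..1::real}.
        u_less C (F x\<^sub>3) ((*\<^sub>R) t\<^sub>0 ` F x\<^sub>1 + (*\<^sub>R) (1 - t\<^sub>0) ` F x\<^sub>2)))"

definition neg_cone_convex :: "'b::real_normed_vector set \<Rightarrow> 'b set \<Rightarrow> bool"
  where "neg_cone_convex C A \<longleftrightarrow> convex (A \<ominus> C)"

definition neg_cone_compact :: "'b::real_normed_vector set \<Rightarrow> 'b set \<Rightarrow> bool"
  where "neg_cone_compact C A \<longleftrightarrow>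
    (\<forall>\<U>. (\<forall>U\<in>\<U>. open U) \<and> A \<subseteq> (\<Union>U\<in>\<U>. U \<ominus> C) \<longrightarrow>
      (\<exists>\<V>\<subseteq>\<U>. finite \<V> \<and> A \<subseteq> (\<Union>U\<in>\<V>. U \<ominus> C)))"

text \<open>
  A neighbourhood of a set (point) is any set whose interior contains it. Neighbourhoods of
  \<open>u\<^sub>0\<close> are taken in the whole domain space, on which the set-valued map is defined.
\<close>

definition neg_cone_usc_at ::
    "'b::real_normed_vector set \<Rightarrow> ('a::topological_space \<Rightarrow> 'b set) \<Rightarrow> 'a \<Rightarrow> bool"
  where "neg_cone_usc_at C F u\<^sub>0 \<longleftrightarrow>
    (\<forall>V. F u\<^sub>0 \<subseteq> interior V \<longrightarrow> (\<forall>\<^sub>F u in nhds u\<^sub>0. F u \<subseteq> V \<ominus> C))"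

definition neg_cone_lsc_at ::
    "'b::real_normed_vector set \<Rightarrow> ('a::topological_space \<Rightarrow> 'b set) \<Rightarrow> 'a \<Rightarrow> bool"
  where "neg_cone_lsc_at C F u\<^sub>0 \<longleftrightarrow>
    (\<forall>y\<in>F u\<^sub>0. \<forall>V. y \<in> interior V \<longrightarrow> (\<forall>\<^sub>F u in nhds u\<^sub>0. F u \<inter> (V + C) \<noteq> {}))"

definition neg_cone_continuous_on ::
    "'b::real_normed_vector set \<Rightarrow> 'a::topological_space set \<Rightarrow> ('a \<Rightarrow> 'b set) \<Rightarrow> bool"
  where "neg_cone_continuous_on C K F \<longleftrightarrow>
    (\<forall>u\<in>K. neg_cone_usc_at C F u \<and> neg_cone_lsc_at C F u)"

text \<open>
  The library's \<^const>\<open>contractible\<close> holds of the empty set. Together with nonemptiness it is the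
  usual notion: a contraction \<open>H\<close> within \<open>A\<close> to a point of \<open>A\<close>.
\<close>

lemma nonempty_contractible_iff:
  fixes A :: "'a::topological_space set"
  shows "A \<noteq> {} \<and> contractible A \<longleftrightarrow>
    (\<exists>x\<^sub>0\<in>A. \<exists>H :: 'a \<times> real \<Rightarrow> 'a. continuous_on (A \<times> {0..1}) H \<and>
      H ` (A \<times> {0..1}) \<subseteq> A \<and> (\<forall>x\<in>A. H (x, 1) = x \<and> H (x, 0) = x\<^sub>0))"
    (is "?L \<longleftrightarrow> ?R")
proof
  assume ?L
  then obtain a where "A \<noteq> {}" and "homotopic_with_canon (\<lambda>x. True) A A id (\<lambda>x. a)"
    unfolding contractible_def by blast
  then have "homotopic_with_canon (\<lambda>x. True) A A (\<lambda>x. a) id"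
    using homotopic_with_sym by blast
  then obtain h :: "real \<times> 'a \<Rightarrow> 'a" where h: "continuous_on ({0..1} \<times> A) h"
      "h ` ({0..1} \<times> A) \<subseteq> A" "\<And>x. x \<in> A \<Longrightarrow> h (0, x) = a" "\<And>x. x \<in> A \<Longrightarrow> h (1, x) = x"
    by (force simp: homotopic_with image_subset_iff_funcset)
  have "a \<in> A"
    using h(2,3) \<open>A \<noteq> {}\<close> by (force simp: image_subset_iff)
  moreover have "continuous_on (A \<times> {0..1}) (h \<circ> prod.swap)"
    by (intro continuous_on_compose continuous_on_swap) (simp add: h(1) product_swap)
  moreover have "(h \<circ> prod.swap) ` (A \<times> {0..1}) \<subseteq> A"
    using h(2) by auto
  ultimately show ?R
    using h(3,4) by (intro bexI[of _ a] exI[of _ "h \<circ> prod.swap"]) auto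
next
  assume ?R
  then obtain a and H :: "'a \<times> real \<Rightarrow> 'a" where H: "a \<in> A" "continuous_on (A \<times> {0..1}) H"
      "H ` (A \<times> {0..1}) \<subseteq> A" "\<And>x. x \<in> A \<Longrightarrow> H (x, 1) = x" "\<And>x. x \<in> A \<Longrightarrow> H (x, 0) = a"
    by blast
  have "continuous_on ({0..1} \<times> A) (H \<circ> prod.swap)"
    by (intro continuous_on_compose continuous_on_swap) (simp add: H(2) product_swap)
  moreover have "(H \<circ> prod.swap) ` ({0..1} \<times> A) \<subseteq> A"
    using H(3) by auto
  ultimately have "homotopic_with_canon (\<lambda>x. True) A A (\<lambda>x. a) id"
    using H(4,5) by (subst homotopic_with) (auto simp: image_subset_iff intro!: exI[of _ "H \<circ> prod.swap"])
  then show ?L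
    using H(1) homotopic_with_sym unfolding contractible_def by blast
qed

end

theory Submission
  imports Defs
begin

text \<open>
  Fix \<open>e\<close> in the interior of \<open>C\<close> and let \<open>g u x\<close> be the least \<open>t\<close> with \<open>F u \<subseteq> F x + t e - C\<close>.
  This is a continuous function on \<open>K \<times> K\<close> that vanishes on the diagonal and satisfies the
  triangle inequality; compactness of the values gives \<open>g u x \<le> 0\<close> iff \<open>F u \<le>\<^sup>u F x\<close>, and
  \<open>g u x < 0\<close> iff \<open>F u \<lless>\<^sup>u F x\<close>. By strict quasi-convexlikeness \<open>g _ x\<close> has exactly one
  minimiser \<open>r x\<close> over \<open>K\<close>, and compactness makes \<open>r\<close> continuous. The triangle inequality shows
  that \<open>r\<close> retracts \<open>K\<close> onto the set of weakly minimal points, which uniqueness identifies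
  with the set of minimal points. A retract of a starshaped set is contractible.
\<close>

section \<open>Retraction onto the points that minimise their own section\<close>

lemma retract_of_self_minimizers:
  fixes g :: "'a::metric_space \<Rightarrow> 'a \<Rightarrow> real"
  assumes K: "compact K" "K \<noteq> {}"
    and cont: "continuous_on (K \<times> K) (\<lambda>(u, x). g u x)"
    and diag: "\<And>x. x \<in> K \<Longrightarrow> g x x = 0"
    and tri: "\<And>x y z. \<lbrakk>x \<in> K; y \<in> K; z \<in> K\<rbrakk> \<Longrightarrow> g x z \<le> g x y + g y z"
    and uniq: "\<And>x u v. \<lbrakk>x \<in> K; u \<in> K; v \<in> K; \<forall>w\<in>K. g u x \<le> g w x; \<forall>w\<in>K. g v x \<le> g w x\<rbrakk> \<Longrightarrow> u = v"
  shows "{x \<in> K. \<forall>u\<in>K. 0 \<le> g u x} retract_of K"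
proof -
  have slice: "continuous_on K (\<lambda>u. g u x)" if "x \<in> K" for x
    using continuous_on_compose2[OF cont, of K "\<lambda>u. (u, x)"] that
    by (force intro!: continuous_intros)
  have "\<exists>u\<in>K. \<forall>w\<in>K. g u x \<le> g w x" if "x \<in> K" for x
    using continuous_attains_inf[OF K slice[OF that]] .
  then obtain r where r: "\<And>x. x \<in> K \<Longrightarrow> r x \<in> K"
      "\<And>x w. x \<in> K \<Longrightarrow> w \<in> K \<Longrightarrow> g (r x) x \<le> g w x"
    by metis
  have r_eq: "r x = u" if "x \<in> K" "u \<in> K" "\<forall>w\<in>K. g u x \<le> g w x" for x u
    using uniq[of x "r x" u] r that by blast
  have "continuous_on K r"
    unfolding continuous_on_closed_vimage[OF compact_imp_closed[OF K(1)]]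
  proof (intro allI impI)
    fix B :: "'a set"
    assume B: "closed B"
    \<comment> \<open>Pairs (x, u) with u in \<open>K \<inter> B\<close> that do at least as well as
      w. Intersecting over all w leaves the part of the graph of \<open>r\<close> over
      \<open>B\<close>; it is compact, and its first projection is the preimage of
      \<open>B\<close>.\<close>
    let ?G = "\<lambda>w. {p \<in> K \<times> (K \<inter> B). g (snd p) (fst p) \<le> g w (fst p)}"
    have KB: "compact (K \<times> (K \<inter> B))"
      using K(1) B by (intro compact_Times compact_Int_closed)
    have "closed (?G w)" if w: "w \<in> K" for w
    proof -
      have "continuous_on (K \<times> (K \<inter> B)) (\<lambda>p. g (snd p) (fst p))"
        using continuous_on_compose2[OF cont, of "K \<times> (K \<inter> B)" "\<lambda>p. (snd p, fst p)"]
        by (force intro!: continuous_intros)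
      moreover have "continuous_on (K \<times> (K \<inter> B)) (\<lambda>p. g w (fst p))"
        using continuous_on_compose2[OF cont, of "K \<times> (K \<inter> B)" "\<lambda>p. (w, fst p)"] w
        by (force intro!: continuous_intros)
      ultimately show ?thesis
        using continuous_on_closed_Collect_le compact_imp_closed[OF KB] by blast
    qed
    then have "compact (K \<times> (K \<inter> B) \<inter> (\<Inter>w\<in>K. ?G w))"
      by (intro compact_Int_closed KB closed_INT) blast
    then have "compact (fst ` (K \<times> (K \<inter> B) \<inter> (\<Inter>w\<in>K. ?G w)))"
      by (intro compact_continuous_image continuous_intros)
    moreover have "r -` B \<inter> K = fst ` (K \<times> (K \<inter> B) \<inter> (\<Inter>w\<in>K. ?G w))"
    proof
      show "r -` B \<inter> K \<subseteq> fst ` (K \<times> (K \<inter> B) \<inter> (\<Inter>w\<in>K. ?G w))"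
      proof
        fix x assume "x \<in> r -` B \<inter> K"
        then have "(x, r x) \<in> K \<times> (K \<inter> B) \<inter> (\<Inter>w\<in>K. ?G w)"
          using r by auto
        then show "x \<in> fst ` (K \<times> (K \<inter> B) \<inter> (\<Inter>w\<in>K. ?G w))"
          by (rule rev_image_eqI) simp
      qed
      show "fst ` (K \<times> (K \<inter> B) \<inter> (\<Inter>w\<in>K. ?G w)) \<subseteq> r -` B \<inter> K"
        using r_eq by auto
    qed
    ultimately show "closed (r -` B \<inter> K)"
      by (simp add: compact_imp_closed)
  qed
  \<comment> \<open>Cancel \<open>g (r x) x\<close> in
    \<open>g (r x) x \<le> g u x \<le> g u (r x) + g (r x) x\<close>.\<close>
  moreover have "0 \<le> g u (r x)" if "x \<in> K" "u \<in> K" for x u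
    using tri[of u "r x" x] r[OF that(1)] that by (smt (verit))
  \<comment> \<open>Here \<open>g x x = 0\<close> is the minimum, so x is itself the
    minimiser.\<close>
  moreover have "r x = x" if "x \<in> K" "\<forall>u\<in>K. 0 \<le> g u x" for x
    using r_eq diag that by simp
  ultimately have "retraction K {x \<in> K. \<forall>u\<in>K. 0 \<le> g u x} r"
    using r(1) unfolding retraction_def by auto
  then show ?thesis
    unfolding retract_of_def by blast
qed

lemma mem_mdiff_iff: "y \<in> B \<ominus> D \<longleftrightarrow> (\<exists>b\<in>B. b - y \<in> D)" for y :: "'b::ab_group_add"
proof
  assume "y \<in> B \<ominus> D"
  then show "\<exists>b\<in>B. b - y \<in> D"
    by (force simp: set_plus_def)
next
  assume "\<exists>b\<in>B. b - y \<in> D"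
  then obtain b where "b \<in> B" "b - y \<in> D" by blast
  then have "b + - (b - y) \<in> B \<ominus> D"
    by (intro set_plus_intro imageI)
  then show "y \<in> B \<ominus> D" by simp
qed

section \<open>Cones with an interior unit\<close>

text \<open>The vector \<open>e\<close> is the direction along which sets are compared. The
  condition \<open>- e \<notin> C\<close> excludes the whole space as cone and later keeps the
  infimum in \<open>excess\<close> finite.\<close>

locale unit_cone =
  fixes C :: "'b::real_normed_vector set" and e :: 'b
  assumes convex_C: "convex C" and closed_C: "closed C" and cone_C: "cone C"
    and unit_interior: "e \<in> interior C" and minus_unit: "- e \<notin> C"
begin

lemma add_C: "x \<in> C \<Longrightarrow> y \<in> C \<Longrightarrow> x + y \<in> C"
  using convex_cone[of C] convex_C cone_C by blast

lemma scale_C: "x \<in> C \<Longrightarrow> 0 \<le> t \<Longrightarrow> t *\<^sub>R x \<in> C"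
  using cone_C unfolding cone_def by blast

lemma unit_C: "e \<in> C"
  using unit_interior interior_subset by blast

lemma zero_C: "0 \<in> C"
  using scale_C[OF unit_C, of 0] by simp

text \<open>The translate of \<open>interior C\<close> by an element of \<open>C\<close> is open and
  contained in \<open>C\<close>.\<close>

lemma add_interior_C: "x \<in> interior C \<Longrightarrow> y \<in> C \<Longrightarrow> x + y \<in> interior C"
proof -
  assume x: "x \<in> interior C" and y: "y \<in> C"
  have "(+) y ` interior C \<subseteq> interior C"
    using y add_C interior_subset
    by (intro interior_maximal open_translation open_interior) blast
  then show ?thesis
    using x by (auto simp: add.commute)
qed

lemma scale_unit_interior: "0 < t \<Longrightarrow> t *\<^sub>R e \<in> interior C"
proof -
  assume t: "0 < t"
  have "(*\<^sub>R) t ` interior C \<subseteq> interior C"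
    using t scale_C interior_subset[of C]
    by (intro interior_maximal open_scaling open_interior) (auto simp: subset_iff)
  then show ?thesis
    using unit_interior by auto
qed

lemma scale_unit_C_iff: "t *\<^sub>R e \<in> C \<longleftrightarrow> 0 \<le> t"
proof
  assume t: "t *\<^sub>R e \<in> C"
  show "0 \<le> t"
  proof (rule ccontr)
    assume "\<not> 0 \<le> t"
    then have "(- 1 / t) *\<^sub>R (t *\<^sub>R e) \<in> C"
      by (intro scale_C t) (simp add: field_simps)
    then show False
      using minus_unit \<open>\<not> 0 \<le> t\<close> by simp
  qed
qed (use scale_C unit_C in blast)

lemma interior_C_minus_unit:
  assumes "x \<in> interior C"
  shows "\<exists>n::nat. x - inverse (Suc n) *\<^sub>R e \<in> interior C"
proof -
  have "(\<lambda>n. x - inverse (real (Suc n)) *\<^sub>R e) \<longlonglongrightarrow> x - 0 *\<^sub>R e"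
    by (intro tendsto_intros LIMSEQ_inverse_real_of_nat)
  then have "\<forall>\<^sub>F n in sequentially. x - inverse (real (Suc n)) *\<^sub>R e \<in> interior C"
    using assms by (intro topological_tendstoD) auto
  then show ?thesis
    by (auto dest: eventually_happens)
qed

text \<open>This makes \<open>e\<close> an order unit: e - x/(n+1) converges to the interior point
  \<open>e\<close>, hence enters \<open>C\<close>, and scaling by n+1 gives the multiple of
  \<open>e\<close>.\<close>

lemma interior_C_absorbs: "\<exists>n::nat. n *\<^sub>R e - x \<in> C"
proof -
  have "(\<lambda>n. e - inverse (real (Suc n)) *\<^sub>R x) \<longlonglongrightarrow> e - 0 *\<^sub>R x"
    by (intro tendsto_intros LIMSEQ_inverse_real_of_nat)
  then have "\<forall>\<^sub>F n in sequentially. e - inverse (real (Suc n)) *\<^sub>R x \<in> interior C"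
    using unit_interior by (intro topological_tendstoD) auto
  then obtain n where "e - inverse (real (Suc n)) *\<^sub>R x \<in> C"
    using interior_subset by (meson eventually_happens subsetD trivial_limit_sequentially)
  then have "real (Suc n) *\<^sub>R (e - inverse (real (Suc n)) *\<^sub>R x) \<in> C"
    by (intro scale_C) auto
  then show ?thesis
    by (intro exI[of _ "Suc n"]) (simp add: scaleR_diff_right del: of_nat_Suc)
qed

lemma C_if_plus_unit:
  assumes "\<And>n::nat. x + inverse (Suc n) *\<^sub>R e \<in> C"
  shows "x \<in> C"
proof -
  have "(\<lambda>n. x + inverse (real (Suc n)) *\<^sub>R e) \<longlonglongrightarrow> x + 0 *\<^sub>R e"
    by (intro tendsto_intros LIMSEQ_inverse_real_of_nat)
  then show ?thesis
    using closed_sequentially[OF closed_C, of "\<lambda>n. x + inverse (real (Suc n)) *\<^sub>R e" x] assms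
    by simp
qed

lemma open_below: "open {z. w - z \<in> interior C}"
proof -
  have "open ((\<lambda>z. w - z) -` interior C)"
    by (intro open_vimage open_interior continuous_intros)
  then show ?thesis
    by (simp add: vimage_def)
qed

text \<open>Sets closed under subtracting \<open>C\<close> satisfy U - C = U, so they form an
  admissible cover; in an increasing sequence a finite subcover lies in a single member. All
  compactness arguments except the finite net in \<open>lsc_below\<close> use this form.\<close>

lemma neg_cone_compact_incseq:
  assumes A: "neg_cone_compact C A"
    and U: "\<And>n. open (U n)" "incseq U" "\<And>n z c. z \<in> U n \<Longrightarrow> c \<in> C \<Longrightarrow> z - c \<in> U n"
    and cover: "A \<subseteq> (\<Union>n. U n)"
  shows "\<exists>n. A \<subseteq> U n"
proof -
  have eq: "U n \<ominus> C = U n" for n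
  proof
    show "U n \<ominus> C \<subseteq> U n"
      using U(3) by (auto simp: set_plus_def)
    show "U n \<subseteq> U n \<ominus> C"
      using zero_C by (force simp: mem_mdiff_iff)
  qed
  have "(\<forall>V\<in>range U. open V) \<and> A \<subseteq> (\<Union>V\<in>range U. V \<ominus> C)"
    using U(1) cover by (simp add: eq)
  then obtain \<V> where "\<V> \<subseteq> range U" "finite \<V>" and sub: "A \<subseteq> (\<Union>V\<in>\<V>. V \<ominus> C)"
    using A unfolding neg_cone_compact_def by meson
  then obtain I where I: "finite I" "\<V> = U ` I"
    using finite_subset_image by metis
  then obtain m where m: "\<And>n. n \<in> I \<Longrightarrow> n \<le> m"
    using Max_ge by blast
  have "A \<subseteq> (\<Union>n\<in>I. U n)"
    using sub by (simp add: I eq)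
  also have "\<dots> \<subseteq> U m"
    using m U(2) by (auto simp: incseq_def)
  finally show ?thesis ..
qed

section \<open>The excess of one set over another\<close>

text \<open>The order \<open>u_le\<close> with the right-hand set shifted by t e, written pointwise;
  t = 0 gives back \<open>u_le\<close>.\<close>

definition below :: "real \<Rightarrow> 'b set \<Rightarrow> 'b set \<Rightarrow> bool"
  where "below t A B \<longleftrightarrow> (\<forall>a\<in>A. \<exists>b\<in>B. b + t *\<^sub>R e - a \<in> C)"

text \<open>A set version of the Gerstewitz scalarization: on singletons it is inf {t. a - b \<in> t
  e - C}. The real \<open>Inf\<close> is meaningful once \<open>below_ex\<close> and
  \<open>below_bdd\<close> hold.\<close>

definition excess :: "'b set \<Rightarrow> 'b set \<Rightarrow> real"
  where "excess A B = Inf {t. below t A B}"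

lemma below_trans:
  assumes "below s A B" "below t B D"
  shows "below (s + t) A D"
  unfolding below_def
proof
  fix a assume "a \<in> A"
  then obtain b d where b: "b + s *\<^sub>R e - a \<in> C" and d: "d \<in> D" "d + t *\<^sub>R e - b \<in> C"
    using assms unfolding below_def by blast
  have "d + (s + t) *\<^sub>R e - a = (b + s *\<^sub>R e - a) + (d + t *\<^sub>R e - b)"
    by (simp add: algebra_simps)
  with d add_C[OF b d(2)] show "\<exists>b\<in>D. b + (s + t) *\<^sub>R e - a \<in> C"
    by metis
qed

lemma below_refl: "0 \<le> t \<Longrightarrow> below t A A"
  unfolding below_def by (auto simp: scale_unit_C_iff intro!: bexI)

lemma below_mono: "below s A B \<Longrightarrow> s \<le> t \<Longrightarrow> below t A B"
  using below_trans[of s A B "t - s" B] below_refl[of "t - s" B] by simp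

text \<open>The sets n e - int C are open, increasing and closed under subtracting \<open>C\<close>,
  and they cover the space because \<open>e\<close> is an order unit.\<close>

lemma neg_cone_compact_bounded:
  assumes "neg_cone_compact C A"
  shows "\<exists>n::nat. \<forall>a\<in>A. n *\<^sub>R e - a \<in> C"
proof -
  let ?U = "\<lambda>n::nat. {z. n *\<^sub>R e - z \<in> interior C}"
  have "\<exists>n. A \<subseteq> ?U n"
  proof (rule neg_cone_compact_incseq[OF assms open_below])
    show "incseq ?U"
    proof (rule incseq_SucI, safe)
      fix n z assume "real n *\<^sub>R e - z \<in> interior C"
      then have "real n *\<^sub>R e - z + e \<in> interior C"
        using unit_C by (rule add_interior_C)
      then show "real (Suc n) *\<^sub>R e - z \<in> interior C"
        by (simp add: algebra_simps)
    qed
    show "z - c \<in> ?U n" if "z \<in> ?U n" "c \<in> C" for n z c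
      using add_interior_C[of "real n *\<^sub>R e - z" c] that by (simp add: algebra_simps)
    show "A \<subseteq> (\<Union>n. ?U n)"
    proof safe
      fix a
      obtain n :: nat where "n *\<^sub>R e - a \<in> C"
        using interior_C_absorbs by blast
      \<comment> \<open>One further copy of \<open>e\<close> moves the difference from
        \<open>C\<close> into its interior.\<close>
      then have "real (Suc n) *\<^sub>R e - a \<in> interior C"
        using add_interior_C[OF unit_interior, of "n *\<^sub>R e - a"] by (simp add: algebra_simps)
      then show "a \<in> (\<Union>n. ?U n)" by blast
    qed
  qed
  then show ?thesis
    using interior_subset by blast
qed

text \<open>Compactness of \<open>B\<close> makes the infimum attained. If no b serves a given a at
  t, closedness of \<open>C\<close> shows that each b already fails at some t + 1/(n+1); these
  failure sets are open and increasing, so one n fails for all of \<open>B\<close>.\<close>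

lemma below_if_below_add:
  assumes B: "neg_cone_compact C B"
    and near: "\<And>n::nat. below (t + inverse (Suc n)) A B"
  shows "below t A B"
  unfolding below_def
proof (rule ballI, rule ccontr)
  fix a assume a: "a \<in> A" and contra: "\<not> (\<exists>b\<in>B. b + t *\<^sub>R e - a \<in> C)"
  let ?U = "\<lambda>n::nat. {z. z + (t + inverse (Suc n)) *\<^sub>R e - a \<notin> C}"
  have "\<exists>n. B \<subseteq> ?U n"
  proof (rule neg_cone_compact_incseq[OF B])
    fix n
    have "open ((\<lambda>z. z + (t + inverse (Suc n)) *\<^sub>R e - a) -` (- C))"
      using closed_C by (intro open_vimage continuous_intros) auto
    then show "open (?U n)"
      by (simp add: vimage_def)
  next
    show "incseq ?U"
    proof (rule incseq_SucI, safe)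
      fix n z
      assume notin: "z + (t + inverse (Suc n)) *\<^sub>R e - a \<notin> C"
        and "z + (t + inverse (Suc (Suc n))) *\<^sub>R e - a \<in> C"
      moreover have "(inverse (Suc n) - inverse (Suc (Suc n))) *\<^sub>R e \<in> C"
        unfolding scale_unit_C_iff by (simp add: field_simps)
      ultimately have "z + (t + inverse (Suc (Suc n))) *\<^sub>R e - a
          + (inverse (Suc n) - inverse (Suc (Suc n))) *\<^sub>R e \<in> C"
        by (rule_tac add_C)
      then show False
        using notin by (simp add: algebra_simps)
    qed
  next
    fix n z c assume "z \<in> ?U n" "c \<in> C"
    then show "z - c \<in> ?U n"
      using add_C[of "z - c + (t + inverse (Suc n)) *\<^sub>R e - a" c] by (auto simp: algebra_simps)
  next
    show "B \<subseteq> (\<Union>n. ?U n)"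
    proof safe
      fix b assume "b \<in> B"
      then have "b + t *\<^sub>R e - a \<notin> C" using contra by blast
      then obtain n :: nat where "b + t *\<^sub>R e - a + inverse (Suc n) *\<^sub>R e \<notin> C"
        using C_if_plus_unit by blast
      then have "b \<in> ?U n" by (simp add: algebra_simps)
      then show "b \<in> (\<Union>n. ?U n)" by blast
    qed
  qed
  then show False
    using near a unfolding below_def by blast
qed

context
  fixes A B :: "'b set"
  assumes A: "A \<noteq> {}" "neg_cone_compact C A" and B: "B \<noteq> {}" "neg_cone_compact C B"
begin

text \<open>All of \<open>A\<close> lies below n e and some b lies above -m e, so t = m + n
  works.\<close>

lemma below_ex: "\<exists>t. below t A B"
proof -
  obtain n :: nat where n: "\<forall>a\<in>A. n *\<^sub>R e - a \<in> C"
    using neg_cone_compact_bounded A by blast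
  obtain b where b: "b \<in> B" using B by blast
  obtain m :: nat where "m *\<^sub>R e - (- b) \<in> C"
    using interior_C_absorbs by blast
  then have "\<forall>a\<in>A. m *\<^sub>R e - (- b) + (n *\<^sub>R e - a) \<in> C"
    using n add_C by blast
  then have "below (m + n) A B"
    unfolding below_def using b by (auto simp: algebra_simps)
  then show ?thesis by blast
qed

text \<open>All of \<open>B\<close> lies below n e and some a lies above -m e. Adding these to the
  relation for t gives (t + n + m) e in \<open>C\<close>, which forces a nonnegative
  coefficient.\<close>

lemma below_bdd: "bdd_below {t. below t A B}"
proof -
  obtain n :: nat where n: "\<forall>b\<in>B. n *\<^sub>R e - b \<in> C"
    using neg_cone_compact_bounded B by blast
  obtain a where a: "a \<in> A" using A by blast
  obtain m :: nat where m: "m *\<^sub>R e - (- a) \<in> C"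
    using interior_C_absorbs by blast
  have "- (real m + real n) \<le> t" if t: "below t A B" for t
  proof -
    obtain b where b: "b \<in> B" "b + t *\<^sub>R e - a \<in> C"
      using t a unfolding below_def by blast
    have "(b + t *\<^sub>R e - a) + (n *\<^sub>R e - b) + (m *\<^sub>R e - (- a)) \<in> C"
      using b n m add_C by blast
    also have "(b + t *\<^sub>R e - a) + (n *\<^sub>R e - b) + (m *\<^sub>R e - (- a)) = (t + n + m) *\<^sub>R e"
      by (simp add: algebra_simps)
    finally show ?thesis
      unfolding scale_unit_C_iff by simp
  qed
  then show ?thesis
    by (intro bdd_belowI) auto
qed

lemma excess_le_iff: "excess A B \<le> t \<longleftrightarrow> below t A B"
proof
  assume le: "excess A B \<le> t"
  show "below t A B"
  proof (rule below_if_below_add[OF B(2)])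
    fix n :: nat
    have "Inf {t. below t A B} < t + inverse (Suc n)"
      using le unfolding excess_def by (simp add: order_le_less_trans)
    then obtain s where "below s A B" "s < t + inverse (Suc n)"
      using cInf_lessD[of "{t. below t A B}"] below_ex by auto
    then show "below (t + inverse (Suc n)) A B"
      using below_mono by simp
  qed
next
  assume "below t A B"
  then show "excess A B \<le> t"
    unfolding excess_def using below_bdd by (simp add: cInf_lower)
qed

text \<open>Forwards, the spare multiple of \<open>e\<close> is an interior vector. Backwards, each
  a tolerates lowering t by some 1/(n+1), and compactness of \<open>A\<close> makes n
  uniform.\<close>

lemma excess_less_iff: "excess A B < t \<longleftrightarrow> (\<forall>a\<in>A. \<exists>b\<in>B. b + t *\<^sub>R e - a \<in> interior C)"
proof
  assume less: "excess A B < t"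
  show "\<forall>a\<in>A. \<exists>b\<in>B. b + t *\<^sub>R e - a \<in> interior C"
  proof
    fix a assume "a \<in> A"
    then obtain b where b: "b \<in> B" "b + excess A B *\<^sub>R e - a \<in> C"
      using excess_le_iff[of "excess A B"] unfolding below_def by blast
    have "(t - excess A B) *\<^sub>R e + (b + excess A B *\<^sub>R e - a) \<in> interior C"
      using less by (intro add_interior_C scale_unit_interior b) simp
    then have "b + t *\<^sub>R e - a \<in> interior C"
      by (simp add: algebra_simps)
    with b show "\<exists>b\<in>B. b + t *\<^sub>R e - a \<in> interior C" by blast
  qed
next
  assume strict: "\<forall>a\<in>A. \<exists>b\<in>B. b + t *\<^sub>R e - a \<in> interior C"
  let ?U = "\<lambda>n::nat. \<Union>b\<in>B. {z. b + (t - inverse (Suc n)) *\<^sub>R e - z \<in> interior C}"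
  have "\<exists>n. A \<subseteq> ?U n"
  proof (rule neg_cone_compact_incseq[OF A(2)])
    show "open (?U n)" for n
      using open_below by blast
    show "incseq ?U"
    proof (rule incseq_SucI, safe)
      fix n z b
      assume b: "b \<in> B" "b + (t - inverse (Suc n)) *\<^sub>R e - z \<in> interior C"
      have "(inverse (Suc n) - inverse (Suc (Suc n))) *\<^sub>R e \<in> C"
        unfolding scale_unit_C_iff by (simp add: field_simps)
      with b(2) have "b + (t - inverse (Suc n)) *\<^sub>R e - z
          + (inverse (Suc n) - inverse (Suc (Suc n))) *\<^sub>R e \<in> interior C"
        by (rule add_interior_C)
      then have "b + (t - inverse (Suc (Suc n))) *\<^sub>R e - z \<in> interior C"
        by (simp add: algebra_simps)
      with b(1) show "z \<in> ?U (Suc n)" by blast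
    qed
    show "z - c \<in> ?U n" if z: "z \<in> ?U n" and c: "c \<in> C" for n z c
    proof -
      obtain b where b: "b \<in> B" "b + (t - inverse (Suc n)) *\<^sub>R e - z \<in> interior C"
        using z by blast
      then have "b + (t - inverse (Suc n)) *\<^sub>R e - z + c \<in> interior C"
        using c by (intro add_interior_C)
      then have "b + (t - inverse (Suc n)) *\<^sub>R e - (z - c) \<in> interior C"
        by (simp add: algebra_simps)
      with b(1) show ?thesis by blast
    qed
    show "A \<subseteq> (\<Union>n. ?U n)"
    proof
      fix a assume "a \<in> A"
      then obtain b where b: "b \<in> B" "b + t *\<^sub>R e - a \<in> interior C"
        using strict by blast
      then obtain n :: nat where "b + t *\<^sub>R e - a - inverse (Suc n) *\<^sub>R e \<in> interior C"
        using interior_C_minus_unit by blast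
      then have "b + (t - inverse (Suc n)) *\<^sub>R e - a \<in> interior C"
        by (simp add: algebra_simps)
      with b(1) show "a \<in> (\<Union>n. ?U n)" by blast
    qed
  qed
  then obtain n :: nat where "below (t - inverse (Suc n)) A B"
    unfolding below_def using interior_subset by blast
  then have "excess A B \<le> t - inverse (Suc n)"
    unfolding excess_le_iff .
  also have "\<dots> < t" by simp
  finally show "excess A B < t" .
qed

lemma u_le_iff_excess: "u_le C A B \<longleftrightarrow> excess A B \<le> 0"
  unfolding excess_le_iff u_le_def below_def by (auto simp: mem_mdiff_iff subset_iff)

lemma u_less_iff_excess: "u_less C A B \<longleftrightarrow> excess A B < 0"
  unfolding excess_less_iff u_less_def by (auto simp: mem_mdiff_iff subset_iff)

end

lemma excess_triangle:
  assumes A: "A \<noteq> {}" "neg_cone_compact C A" and B: "B \<noteq> {}" "neg_cone_compact C B"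
    and D: "D \<noteq> {}" "neg_cone_compact C D"
  shows "excess A D \<le> excess A B + excess B D"
  using excess_le_iff[OF A B] excess_le_iff[OF B D] excess_le_iff[OF A D] below_trans by blast

text \<open>Reflexivity bounds the value above by 0; the triangle inequality says that it is at most
  twice itself, hence at least 0.\<close>

lemma excess_self:
  assumes A: "A \<noteq> {}" "neg_cone_compact C A"
  shows "excess A A = 0"
  using excess_le_iff[OF A A, of 0] below_refl[of 0 A] excess_triangle[OF A A A] by simp

section \<open>Continuity of the excess\<close>

text \<open>Upper semicontinuity is applied to the open neighbourhood F u0 + t e - int C, which is
  unchanged by subtracting \<open>C\<close>.\<close>

lemma usc_below:
  assumes "neg_cone_usc_at C F u\<^sub>0" "0 < t"
  shows "\<forall>\<^sub>F u in nhds u\<^sub>0. below t (F u) (F u\<^sub>0)"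
proof -
  let ?V = "\<Union>b\<in>F u\<^sub>0. {z. b + t *\<^sub>R e - z \<in> interior C}"
  have "open ?V"
    using open_below by blast
  moreover have "F u\<^sub>0 \<subseteq> ?V"
    using scale_unit_interior[OF assms(2)] by force
  ultimately have "\<forall>\<^sub>F u in nhds u\<^sub>0. F u \<subseteq> ?V \<ominus> C"
    using assms(1) unfolding neg_cone_usc_at_def by (simp add: interior_open)
  then show ?thesis
  proof eventually_elim
    case (elim u)
    show ?case
      unfolding below_def
    proof
      fix a assume "a \<in> F u"
      then obtain v b where "v - a \<in> C" "b \<in> F u\<^sub>0" "b + t *\<^sub>R e - v \<in> interior C"
        using elim by (auto simp: subset_iff mem_mdiff_iff)
      then show "\<exists>b\<in>F u\<^sub>0. b + t *\<^sub>R e - a \<in> C"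
        using add_C[of "b + t *\<^sub>R e - v" "v - a"] interior_subset by (intro bexI[of _ b]) auto
    qed
  qed
qed

text \<open>Lower semicontinuity speaks of single points. Compactness reduces
  \<open>F u\<^sub>0\<close> to a finite net \<open>I\<close>, over which the neighbourhoods can be
  intersected.\<close>

lemma lsc_below:
  assumes lsc: "neg_cone_lsc_at C F u\<^sub>0" and comp: "neg_cone_compact C (F u\<^sub>0)" and t: "0 < t"
  shows "\<forall>\<^sub>F u in nhds u\<^sub>0. below t (F u\<^sub>0) (F u)"
proof -
  \<comment> \<open>Half of t pays for passing from \<open>F u\<^sub>0\<close> to the net, the other
    half from the net to \<open>F u\<close>.\<close>
  let ?s = "t / 2"
  let ?U = "\<lambda>b. {z. b + ?s *\<^sub>R e - z \<in> interior C}"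
  have s: "?s *\<^sub>R e \<in> interior C"
    using t by (intro scale_unit_interior) simp
  have "a \<in> ?U a \<ominus> C" for a
    unfolding mem_mdiff_iff using s zero_C by (intro bexI[of _ a]) auto
  then have "F u\<^sub>0 \<subseteq> (\<Union>U\<in>?U ` F u\<^sub>0. U \<ominus> C)"
    by blast
  then obtain \<V> where \<V>: "\<V> \<subseteq> ?U ` F u\<^sub>0" "finite \<V>" "F u\<^sub>0 \<subseteq> (\<Union>U\<in>\<V>. U \<ominus> C)"
    using comp[unfolded neg_cone_compact_def, rule_format, of "?U ` F u\<^sub>0"] open_below by blast
  then obtain I where I: "finite I" "I \<subseteq> F u\<^sub>0" "\<V> = ?U ` I"
    using finite_subset_image[OF \<V>(2,1)] by blast
  have "\<forall>\<^sub>F u in nhds u\<^sub>0. \<exists>y\<in>F u. y + ?s *\<^sub>R e - b \<in> C" if "b \<in> I" for b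
  proof -
    let ?V = "{z. z + ?s *\<^sub>R e - b \<in> interior C}"
    have "open ((\<lambda>z. z + ?s *\<^sub>R e - b) -` interior C)"
      by (intro open_vimage open_interior continuous_intros)
    then have "open ?V"
      by (simp add: vimage_def)
    moreover have "b \<in> ?V" using s by simp
    ultimately have "\<forall>\<^sub>F u in nhds u\<^sub>0. F u \<inter> (?V + C) \<noteq> {}"
      using lsc that I(2) unfolding neg_cone_lsc_at_def by (auto simp: interior_open)
    then show ?thesis
    proof eventually_elim
      case (elim u)
      then obtain v c where vc: "v + c \<in> F u" "v + ?s *\<^sub>R e - b \<in> interior C" "c \<in> C"
        by (auto simp: set_plus_def)
      have "(v + ?s *\<^sub>R e - b) + c \<in> C"
        using vc interior_subset add_C by blast
      then have "(v + c) + ?s *\<^sub>R e - b \<in> C"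
        by (simp add: algebra_simps)
      with vc(1) show ?case by blast
    qed
  qed
  then have "\<forall>\<^sub>F u in nhds u\<^sub>0. \<forall>b\<in>I. \<exists>y\<in>F u. y + ?s *\<^sub>R e - b \<in> C"
    using I(1) by (simp add: eventually_ball_finite)
  then show ?thesis
  proof eventually_elim
    case (elim u)
    have "below ?s (F u\<^sub>0) I"
      unfolding below_def
    proof
      fix a assume "a \<in> F u\<^sub>0"
      then obtain b z where bz: "b \<in> I" "b + ?s *\<^sub>R e - z \<in> interior C" "z - a \<in> C"
        using \<V>(3) unfolding I(3) by (auto simp: subset_iff mem_mdiff_iff)
      then have "b + ?s *\<^sub>R e - z + (z - a) \<in> C"
        using interior_subset add_C by blast
      with bz(1) show "\<exists>b\<in>I. b + ?s *\<^sub>R e - a \<in> C" by auto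
    qed
    moreover have "below ?s I (F u)"
      using elim unfolding below_def by blast
    ultimately show ?case
      using below_trans by fastforce
  qed
qed

lemma continuous_on_excess:
  assumes cont: "neg_cone_continuous_on C K F"
    and val: "\<forall>x\<in>K. F x \<noteq> {} \<and> neg_cone_compact C (F x)"
  shows "continuous_on (K \<times> K) (\<lambda>(u, x). excess (F u) (F x))"
  unfolding continuous_on_def
proof (rule ballI, rule tendstoI)
  fix p :: "'a \<times> 'a" and d :: real
  assume p: "p \<in> K \<times> K" and d: "0 < d"
  obtain u\<^sub>0 x\<^sub>0 where p_eq: "p = (u\<^sub>0, x\<^sub>0)" and K: "u\<^sub>0 \<in> K" "x\<^sub>0 \<in> K"
    using p by blast
  \<comment> \<open>Each of the two arguments costs at most d/3 in either direction, so the total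
    change is at most 2d/3 < d.\<close>
  define P where "P w\<^sub>0 w \<longleftrightarrow> below (d / 3) (F w) (F w\<^sub>0) \<and> below (d / 3) (F w\<^sub>0) (F w)" for w\<^sub>0 w
  have P: "eventually (P w) (nhds w)" if "w \<in> K" for w
    unfolding P_def using that cont val d
    by (intro eventually_conj usc_below lsc_below) (auto simp: neg_cone_continuous_on_def)
  have "\<forall>\<^sub>F (u, x) in nhds p. P u\<^sub>0 u \<and> P x\<^sub>0 x"
    unfolding p_eq nhds_prod case_prod_unfold
    using eventually_prodI[OF P[OF K(1)] P[OF K(2)]] by (simp add: case_prod_unfold)
  then show "\<forall>\<^sub>F q in at p within K \<times> K.
      dist (case q of (u, x) \<Rightarrow> excess (F u) (F x)) (case p of (u, x) \<Rightarrow> excess (F u) (F x)) < d"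
    unfolding eventually_at_filter
  proof eventually_elim
    case (elim q)
    show ?case
    proof (intro impI)
      assume "q \<in> K \<times> K"
      then obtain u x where q: "q = (u, x)" "u \<in> K" "x \<in> K" by blast
      let ?g = "\<lambda>u x. excess (F u) (F x)"
      have Pq: "P u\<^sub>0 u" "P x\<^sub>0 x"
        using elim q by simp_all
      have le: "?g a b \<le> d / 3" if "a \<in> K" "b \<in> K" "below (d / 3) (F a) (F b)" for a b
        using that val excess_le_iff by blast
      have "?g u u\<^sub>0 \<le> d / 3" "?g u\<^sub>0 u \<le> d / 3" "?g x x\<^sub>0 \<le> d / 3" "?g x\<^sub>0 x \<le> d / 3"
        using le Pq q K unfolding P_def by blast+
      moreover have "?g a c \<le> ?g a b + ?g b c" if "a \<in> K" "b \<in> K" "c \<in> K" for a b c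
        using that val by (simp add: excess_triangle)
      from this[of u u\<^sub>0 x] this[of u\<^sub>0 x\<^sub>0 x] this[of u\<^sub>0 u x\<^sub>0] this[of u x x\<^sub>0]
      have "?g u x \<le> ?g u u\<^sub>0 + ?g u\<^sub>0 x\<^sub>0 + ?g x\<^sub>0 x" "?g u\<^sub>0 x\<^sub>0 \<le> ?g u\<^sub>0 u + ?g u x + ?g x x\<^sub>0"
        using q K by linarith+
      ultimately show "dist (case q of (u, x) \<Rightarrow> ?g u x) (case p of (u, x) \<Rightarrow> ?g u x) < d"
        using d by (simp add: q p_eq dist_real_def abs_less_iff)
    qed
  qed
qed

section \<open>Unique minimisers and the two solution sets\<close>

text \<open>If u and v both attain the minimum m, then F u and F v lie in the convex set F x + m e -
  C, and so do their convex combinations. A w with F w strictly below such a combination would have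
  excess less than m.\<close>

lemma excess_minimizer_unique:
  assumes sq: "strictly_quasi_u_convexlike_on C F K"
    and val: "\<forall>x\<in>K. F x \<noteq> {} \<and> neg_cone_convex C (F x) \<and> neg_cone_compact C (F x)"
    and K: "x \<in> K" "u \<in> K" "v \<in> K"
    and min: "\<forall>w\<in>K. excess (F u) (F x) \<le> excess (F w) (F x)"
      "\<forall>w\<in>K. excess (F v) (F x) \<le> excess (F w) (F x)"
  shows "u = v"
proof (rule ccontr)
  assume "u \<noteq> v"
  then obtain w s where w: "w \<in> K" "s \<in> {0..1}"
      "u_less C (F w) ((*\<^sub>R) s ` F u + (*\<^sub>R) (1 - s) ` F v)"
    using sq K unfolding strictly_quasi_u_convexlike_on_def by meson
  define m where "m = excess (F u) (F x)"
  have "excess (F v) (F x) = m"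
    using min K by (simp add: m_def order_antisym)
  then have "below m (F u) (F x)" "below m (F v) (F x)"
    using K val by (simp_all add: excess_le_iff[symmetric] m_def)
  \<comment> \<open>Shifting by m e allows the convexity of F x - C to be applied as it
    stands.\<close>
  then have shift: "y - m *\<^sub>R e \<in> F x \<ominus> C" if "y \<in> F u \<union> F v" for y
    using that unfolding below_def mem_mdiff_iff by (auto simp: algebra_simps)
  have conv: "convex (F x \<ominus> C)"
    using val K unfolding neg_cone_convex_def by blast
  have "\<exists>b\<in>F x. b + m *\<^sub>R e - a \<in> interior C" if a: "a \<in> F w" for a
  proof -
    obtain y z where yz: "y \<in> F u" "z \<in> F v" "(s *\<^sub>R y + (1 - s) *\<^sub>R z) - a \<in> interior C"
      using w(3) a unfolding u_less_def subset_iff mem_mdiff_iff by (auto simp: set_plus_def)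
    have "s *\<^sub>R (y - m *\<^sub>R e) + (1 - s) *\<^sub>R (z - m *\<^sub>R e) \<in> F x \<ominus> C"
      using w(2) yz by (intro convexD[OF conv] shift) auto
    then obtain b where b: "b \<in> F x"
        "b - (s *\<^sub>R (y - m *\<^sub>R e) + (1 - s) *\<^sub>R (z - m *\<^sub>R e)) \<in> C"
      unfolding mem_mdiff_iff by blast
    \<comment> \<open>The weights s and 1 - s sum to 1, so the total is b + m e - a.\<close>
    have "(s *\<^sub>R y + (1 - s) *\<^sub>R z) - a
        + (b - (s *\<^sub>R (y - m *\<^sub>R e) + (1 - s) *\<^sub>R (z - m *\<^sub>R e))) \<in> interior C"
      by (rule add_interior_C[OF yz(3) b(2)])
    then have "b + m *\<^sub>R e - a \<in> interior C"
      by (simp add: algebra_simps)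
    with b(1) show ?thesis by blast
  qed
  then have "excess (F w) (F x) < m"
    using w(1) K val by (simp add: excess_less_iff)
  then show False
    using min(1) w(1) unfolding m_def by force
qed

text \<open>Two opposite excesses have nonnegative sum, so the strict relation never holds in both
  directions; the implication defining weak minimality can only hold vacuously.\<close>

lemma weak_u_minimal_eq:
  assumes val: "\<forall>x\<in>K. F x \<noteq> {} \<and> neg_cone_compact C (F x)"
  shows "weak_u_minimal C F K = {x \<in> K. \<forall>u\<in>K. 0 \<le> excess (F u) (F x)}"
proof -
  have "\<not> excess (F x) (F u) < 0" if "x \<in> K" "u \<in> K" "excess (F u) (F x) < 0" for u x
    using excess_triangle[of "F x" "F u" "F x"] excess_self[of "F x"] that val by simp
  then show ?thesis
    unfolding weak_u_minimal_def using val by (auto simp: u_less_iff_excess) (meson not_le)+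
qed

text \<open>A negative excess of u over a minimal x would make the reverse one positive,
  contradicting minimality. Conversely, if x is weakly minimal, then 0 is the minimum of the excess
  over F x and is attained at x; any u with excess at most 0 attains it too, so u = x.\<close>

lemma u_minimal_eq_weak_u_minimal:
  assumes sq: "strictly_quasi_u_convexlike_on C F K"
    and val: "\<forall>x\<in>K. F x \<noteq> {} \<and> neg_cone_convex C (F x) \<and> neg_cone_compact C (F x)"
  shows "u_minimal C F K = weak_u_minimal C F K"
proof -
  have val': "\<forall>x\<in>K. F x \<noteq> {} \<and> neg_cone_compact C (F x)"
    using val by blast
  have self: "excess (F x) (F x) = 0" if "x \<in> K" for x
    using that val by (simp add: excess_self)
  have "0 \<le> excess (F u) (F x)"
    if "x \<in> K" "u \<in> K" "excess (F u) (F x) \<le> 0 \<longrightarrow> excess (F x) (F u) \<le> 0" for u x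
    using excess_triangle[of "F x" "F u" "F x"] self that val by force
  moreover have "u = x"
    if "x \<in> K" "u \<in> K" "\<forall>w\<in>K. 0 \<le> excess (F w) (F x)" "excess (F u) (F x) \<le> 0" for u x
    using excess_minimizer_unique[OF sq val that(1,2,1)] that self by force
  ultimately show ?thesis
    unfolding weak_u_minimal_eq[OF val'] u_minimal_def
    using val by (auto simp: u_le_iff_excess) (metis self order_refl)
qed

end

section \<open>Contractibility of the solution sets\<close>

theorem theorem4p1:
  fixes K :: "'a::real_normed_vector set"
    and F :: "'a \<Rightarrow> 'b::banach set"
    and C :: "'b set"
  assumes "convex C" and "closed C" and "pointed_cone C" and "interior C \<noteq> {}"
    and "K \<noteq> {}" and "compact K" and "starlike K"
    and "neg_cone_continuous_on C K F"
    and "strictly_quasi_u_convexlike_on C F K"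
    and "\<forall>x\<in>K. F x \<noteq> {} \<and> neg_cone_convex C (F x) \<and> neg_cone_compact C (F x)"
  shows "(weak_u_minimal C F K \<noteq> {} \<and> contractible (weak_u_minimal C F K)) \<and>
    (u_minimal C F K \<noteq> {} \<and> contractible (u_minimal C F K))"
proof -
  have K: "contractible K"
    using \<open>starlike K\<close> by (rule starlike_imp_contractible)
  obtain e where e: "e \<in> interior C"
    using \<open>interior C \<noteq> {}\<close> by blast
  show ?thesis
  proof (cases "- e \<in> C")
    case True
    \<comment> \<open>Here \<open>e = 0\<close> is interior to \<open>C\<close>, so \<open>C\<close> is the whole space and every point is minimal.\<close>
    moreover have "e \<in> C"
      using e interior_subset by blast
    ultimately have "e \<in> C \<inter> uminus ` C"
      by force
    then have "e = 0"
      using \<open>pointed_cone C\<close> unfolding pointed_cone_def by blast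
    then obtain d where d: "d > 0" "ball 0 d \<subseteq> C"
      using e by (auto simp: mem_interior)
    have "y \<in> C" for y
    proof -
      \<comment> \<open>Scales y into the ball of radius d; the added 1 covers y = 0 and makes the
        bound strict.\<close>
      define t where "t = d / (norm y + 1)"
      have pos: "0 < norm y + 1" by (simp add: add_nonneg_pos)
      then have t: "t > 0" using d(1) unfolding t_def by simp
      have "norm (t *\<^sub>R y) < t * (norm y + 1)"
        using t by simp
      also have "\<dots> = d"
        using pos unfolding t_def by simp
      finally have "norm (t *\<^sub>R y) < d" .
      then have "t *\<^sub>R y \<in> C" using d(2) by (auto simp: subset_iff)
      then have "(1 / t) *\<^sub>R (t *\<^sub>R y) \<in> C"
        using \<open>pointed_cone C\<close> t unfolding pointed_cone_def cone_def
        by (meson divide_nonneg_pos zero_le_one)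
      then show ?thesis using t by simp
    qed
    then have "C = UNIV" by blast
    \<comment> \<open>With nonempty values both relations then hold between any two values on
      \<open>K\<close>, so each defining implication is trivially true.\<close>
    moreover have "B \<ominus> UNIV = UNIV" if "B \<noteq> {}" for B :: "'b set"
      using that unfolding set_eq_iff mem_mdiff_iff by blast
    ultimately have "u_le C (F x) (F y)" "u_less C (F x) (F y)" if "y \<in> K" for x y
      using that assms(10) unfolding u_le_def u_less_def by simp_all
    then have "weak_u_minimal C F K = K" "u_minimal C F K = K"
      unfolding weak_u_minimal_def u_minimal_def by auto
    then show ?thesis
      using K \<open>K \<noteq> {}\<close> by simp
  next
    case False
    interpret unit_cone C e
      using assms e False by unfold_locales (auto simp: pointed_cone_def)
    have val: "\<forall>x\<in>K. F x \<noteq> {} \<and> neg_cone_compact C (F x)"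
      using assms(10) by blast
    have "{x \<in> K. \<forall>u\<in>K. 0 \<le> excess (F u) (F x)} retract_of K"
    proof (rule retract_of_self_minimizers[OF \<open>compact K\<close> \<open>K \<noteq> {}\<close>])
      show "continuous_on (K \<times> K) (\<lambda>(u, x). excess (F u) (F x))"
        using assms(8) val by (rule continuous_on_excess)
      show "excess (F x) (F x) = 0" if "x \<in> K" for x
        using that val by (simp add: excess_self)
      show "excess (F x) (F z) \<le> excess (F x) (F y) + excess (F y) (F z)"
        if "x \<in> K" "y \<in> K" "z \<in> K" for x y z
        using that val by (simp add: excess_triangle)
    qed (rule excess_minimizer_unique[OF assms(9,10)])
    then have retract: "weak_u_minimal C F K retract_of K"
      unfolding weak_u_minimal_eq[OF val] .
    then have "weak_u_minimal C F K \<noteq> {}"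
      using \<open>K \<noteq> {}\<close> by auto
    moreover have "contractible (weak_u_minimal C F K)"
      using K retract by (rule retract_of_contractible)
    ultimately show ?thesis
      using u_minimal_eq_weak_u_minimal[OF assms(9,10)] by simp
  qed
qed

end
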